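(* Let $A$ be a triassociative algebra over a field $K$. If $H^3_{\mathrm{Trias}}(A,A)$ is trivial, then every $2$-cocycle in $C^2_{\mathrm{Trias}}(A,A)$ is the infinitesimal of some deformation of $A$.
   Context: All vector spaces and tensor products are over a fixed field $K$. A triassociative algebra is a vector space $A$ with three bilinear operations $L=\dashv$, $R=\vdash$, $M=\bot$ satisfying, for all $x,y,z$, the following $11$ conditions: (1) $L(L(x,y),z)=L(x,L(y,z))$; (2) $L(L(x,y),z)=L(x,R(y,z))$; (3) $L(R(x,y),z)=R(x,L(y,z))$; (4) $R(L(x,y),z)=R(x,R(y,z))$; (5) $R(R(x,y),z)=R(x,R(y,z))$; (6) $L(L(x,y),z)=L(x,M(y,z))$; (7) $L(M(x,y),z)=M(x,L(y,z))$; (8) $M(L(x,y),z)=M(x,R(y,z))$; (9) $M(R(x,y),z)=R(x,M(y,z))$; (10) $R(M(x,y),z)=R(x,R(y,z))$; (11) $M(M(x,y),z)=M(x,M(y,z))$, where $L(x,y)=x\dashv y$, etc. Trees. $T_n$ ($n\ge0$) is the set of planar rooted trees with $n+1$ leaves in which every internal vertex has at least $2$ incoming edges ($T_0=\{|\}$, no internal vertex); $\psi\in T_n$ has degree $|\psi|=n$; leaves are numbered $0,\dots,n$ from left to right. The grafting $\psi_0\vee\cdots\vee\psi_k$ is obtained by arranging the trees from left to right and joining their roots to a new lowest internal vertex, connected to a new root; every tree of degree $\ge 1$ is uniquely of this form with $k\ge1$. A leaf is left (resp. right) oriented if it is the leftmost (resp. rightmost) incoming edge of the vertex it is attached to; otherwise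 it is a middle leaf. $d_i\colon T_{n+1}\to T_n$ deletes the $i$th leaf (suppressing any vertex left with one incoming edge). For $\psi=\psi_0\vee\cdots\vee\psi_k\in T_{n+1}$ and $0\le i\le n+1$ define $\circ_i^\psi\in\{\dashv,\vdash,\bot\}$ by: $\circ_0^\psi$ is $\dashv$ if $|\psi_0|=0$ and $k=1$; $\vdash$ if $|\psi_0|>0$; $\bot$ if $|\psi_0|=0$ and $k>1$. For $1\le i\le n$, $\circ_i^\psi$ is $\dashv$, $\vdash$, or $\bot$ according as the $i$th leaf is left oriented, right oriented, or a middle leaf. $\circ_{n+1}^\psi$ is $\dashv$ if $|\psi_k|>0$; $\vdash$ if $k=1$ and $|\psi_1|=0$; $\bot$ if $k>1$ and $|\psi_k|=0$. Cohomology. $C^n_{\mathrm{Trias}}(A,A)=\mathrm{Hom}_K(K[T_n]\otimes A^{\otimes n},A)$ for $n\ge 0$, with coboundary $\delta^n=\sum_{i=0}^{n+1}(-1)^i\delta_i^n\colon C^n_{\mathrm{Trias}}(A,A)\to C^{n+1}_{\mathrm{Trias}}(A,A)$, where for $\psi\in T_{n+1}$, $a_1,\dots,a_{n+1}\in A$: $(\delta_0^nf)(\psi;a_1,\dots,a_{n+1})=a_1\circ_0^\psi f(d_0\psi;a_2,\dots,a_{n+1})$; $(\delta_i^nf)(\psi;a_1,\dots,a_{n+1})=f(d_i\psi;a_1,\dots,a_i\circ_i^\psi a_{i+1},\dots,a_{n+1})$ for $1\le i\le n$; $(\delta_{n+1}^nf)(\psi;a_1,\dots,a_{n+1})=f(d_{n+1}\psi;a_1,\dots,a_n)\circ_{n+1}^\psi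 a_{n+1}$. This is a cochain complex, and $H^n_{\mathrm{Trias}}(A,A)$ is its $n$th cohomology. A $2$-cochain $\theta\in C^2_{\mathrm{Trias}}(A,A)$ is identified with a triple $(\lambda,\rho,\mu)$ of bilinear operations on $A$ by $\theta(\psi;x,y)=\lambda(x,y)$, $\rho(x,y)$, $\mu(x,y)$ for $\psi=|\vee(|\vee|)$, $(|\vee|)\vee|$, $|\vee|\vee|$ respectively. A deformation of $A$ is a power series $\Theta_t=\sum_{i=0}^\infty\theta_it^i$ with each $\theta_i=(\lambda_i,\rho_i,\mu_i)\in C^2_{\mathrm{Trias}}(A,A)$ and $\theta_0=(\dashv,\vdash,\bot)$, such that $L_t=\sum\lambda_it^i$, $R_t=\sum\rho_it^i$, $M_t=\sum\mu_it^i$ satisfy conditions (1)-(11) (with $L_t,R_t,M_t$ in place of $L,R,M$, extended linearly to power series) for all $x,y,z\in A$. The infinitesimal of $\Theta_t$ is its linear coefficient $\theta_1$. *)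

theory Defs
  imports Complex_Main "HOL-Computational_Algebra.Formal_Power_Series"
begin

text \<open>
  \<open>Graft [t\<^sub>0, \<dots>, t\<^sub>k]\<close> is the grafting \<open>t\<^sub>0 \<or> \<dots> \<or> t\<^sub>k\<close>.  The datatype also contains
  graftings of fewer than two trees; these are excluded from \<open>trees n\<close> by \<open>reduced\<close>.
\<close>

datatype ptree = Lf | Graft "ptree list"

fun reduced :: "ptree \<Rightarrow> bool" where
  "reduced Lf \<longleftrightarrow> True"
| "reduced (Graft ts) \<longleftrightarrow> 2 \<le> length ts \<and> (\<forall>t\<in>set ts. reduced t)"

fun leaves :: "ptree \<Rightarrow> nat" where
  "leaves Lf = 1"
| "leaves (Graft ts) = sum_list (map leaves ts)"

definition trees :: "nat \<Rightarrow> ptree set" where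
  "trees n = {\<psi>. reduced \<psi> \<and> leaves \<psi> = n + 1}"

definition tree_degree :: "ptree \<Rightarrow> nat" where
  "tree_degree \<psi> = leaves \<psi> - 1"

fun suppress_unary :: "ptree list \<Rightarrow> ptree" where
  "suppress_unary [t] = t"
| "suppress_unary ts = Graft ts"

text \<open>
  The face map \<open>d\<^sub>i\<close>.  Leaves are numbered from left to right starting with \<open>0\<close>; in a forest the
  numbering runs through all its trees.  A tree \<open>Lf\<close> disappears from a forest when its leaf is
  deleted.  The value on the tree \<open>Lf\<close> itself is immaterial, as \<open>d\<^sub>i\<close> is only defined in
  positive degree.
\<close>

fun del_leaf :: "nat \<Rightarrow> ptree \<Rightarrow> ptree"
  and del_leaf_forest :: "nat \<Rightarrow> ptree list \<Rightarrow> ptree list" where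
  "del_leaf i Lf = Lf"
| "del_leaf i (Graft ts) = suppress_unary (del_leaf_forest i ts)"
| "del_leaf_forest i [] = []"
| "del_leaf_forest i (t # ts) =
     (if i < leaves t then (if t = Lf then ts else del_leaf i t # ts)
      else t # del_leaf_forest (i - leaves t) ts)"

datatype orientation = Left_Oriented | Right_Oriented | Middle_Leaf

definition child_orientation :: "nat \<Rightarrow> nat \<Rightarrow> orientation" where
  "child_orientation m j =
     (if j = 0 then Left_Oriented else if j = m - 1 then Right_Oriented else Middle_Leaf)"

lemma size_nth_less_size_list [termination_simp]:
  "j < length ts \<Longrightarrow> size (ts ! j) < Suc (size_list size ts)"
  by (metis le_imp_less_Suc nth_mem order_refl size_list_estimation')

text \<open>
  The orientations of all leaves of a tree, from left to right.  The first argument is the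
  orientation of the root edge of the tree as an incoming edge of the vertex it is attached to;
  it matters only for the tree \<open>Lf\<close>.
\<close>

fun orientations :: "orientation \<Rightarrow> ptree \<Rightarrow> orientation list" where
  "orientations p Lf = [p]"
| "orientations p (Graft ts) =
     concat (map (\<lambda>j. orientations (child_orientation (length ts) j) (ts ! j)) [0..<length ts])"

definition leaf_orientation :: "ptree \<Rightarrow> nat \<Rightarrow> orientation" where
  "leaf_orientation \<psi> i = orientations Middle_Leaf \<psi> ! i"

text \<open>\<open>Dashv\<close>, \<open>Vdash\<close>, \<open>Perp\<close> name the products \<open>L\<close>, \<open>R\<close>, \<open>M\<close> respectively.\<close>

datatype trias_symbol = Dashv | Vdash | Perp

fun orientation_symbol :: "orientation \<Rightarrow> trias_symbol" where
  "orientation_symbol Left_Oriented = Dashv"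
| "orientation_symbol Right_Oriented = Vdash"
| "orientation_symbol Middle_Leaf = Perp"

text \<open>
  The symbol \<open>\<circ>\<^sub>i\<^sup>\<psi>\<close> for \<open>0 \<le> i \<le> tree_degree \<psi>\<close>.  For \<open>\<psi> = t\<^sub>0 \<or> \<dots> \<or> t\<^sub>k\<close> the list of subtrees has
  length \<open>k + 1\<close>, so \<open>k = 1\<close> reads \<open>length ts = 2\<close>.
\<close>

fun circ_symbol :: "ptree \<Rightarrow> nat \<Rightarrow> trias_symbol" where
  "circ_symbol Lf i = undefined"
| "circ_symbol (Graft ts) i =
     (if i = 0 then
        (if tree_degree (hd ts) > 0 then Vdash else if length ts = 2 then Dashv else Perp)
      else if i = tree_degree (Graft ts) then
        (if tree_degree (last ts) > 0 then Dashv else if length ts = 2 then Vdash else Perp)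
      else orientation_symbol (leaf_orientation (Graft ts) i))"

definition trias_identities ::
  "('b \<Rightarrow> 'b \<Rightarrow> 'b) \<Rightarrow> ('b \<Rightarrow> 'b \<Rightarrow> 'b) \<Rightarrow> ('b \<Rightarrow> 'b \<Rightarrow> 'b) \<Rightarrow> 'b \<Rightarrow> 'b \<Rightarrow> 'b \<Rightarrow> bool" where
  "trias_identities L R M x y z \<longleftrightarrow>
     L (L x y) z = L x (L y z) \<and>
     L (L x y) z = L x (R y z) \<and>
     L (R x y) z = R x (L y z) \<and>
     R (L x y) z = R x (R y z) \<and>
     R (R x y) z = R x (R y z) \<and>
     L (L x y) z = L x (M y z) \<and>
     L (M x y) z = M x (L y z) \<and>
     M (L x y) z = M x (R y z) \<and>
     M (R x y) z = R x (M y z) \<and>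
     R (M x y) z = R x (R y z) \<and>
     M (M x y) z = M x (M y z)"

definition bilinear_operation ::
  "('k::field \<Rightarrow> 'a::ab_group_add \<Rightarrow> 'a) \<Rightarrow> ('a \<Rightarrow> 'a \<Rightarrow> 'a) \<Rightarrow> bool" where
  "bilinear_operation scale B \<longleftrightarrow>
     (\<forall>x. Vector_Spaces.linear scale scale (\<lambda>y. B x y)) \<and>
     (\<forall>y. Vector_Spaces.linear scale scale (\<lambda>x. B x y))"

locale triassociative_algebra = vector_space scale
  for scale :: "'k::field \<Rightarrow> 'a::ab_group_add \<Rightarrow> 'a" +
  fixes L R M :: "'a \<Rightarrow> 'a \<Rightarrow> 'a"
  assumes bilinear_L: "bilinear_operation scale L"
    and bilinear_R: "bilinear_operation scale R"
    and bilinear_M: "bilinear_operation scale M"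
    and identities: "trias_identities L R M x y z"

text \<open>
  A linear map from \<open>K[T\<^sub>n] \<otimes> A\<^bsup>\<otimes>n\<^esup>\<close> to \<open>A\<close> amounts to a family, indexed by \<open>T\<^sub>n\<close>, of \<open>n\<close>-linear
  maps from \<open>A\<^sup>n\<close> to \<open>A\<close>.  Arguments \<open>a\<^sub>1, \<dots>, a\<^sub>n\<close> are lists of length \<open>n\<close>, so \<open>a\<^sub>i\<close> is \<open>as ! (i - 1)\<close>.
  Cochains vanish outside their domain, so that equality of cochains is equality of functions.
\<close>

type_synonym 'a cochain = "ptree \<Rightarrow> 'a list \<Rightarrow> 'a"

definition multilinear_list ::
  "('k::field \<Rightarrow> 'a::ab_group_add \<Rightarrow> 'a) \<Rightarrow> nat \<Rightarrow> ('a list \<Rightarrow> 'a) \<Rightarrow> bool" where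
  "multilinear_list scale n g \<longleftrightarrow>
     (\<forall>as i. length as = n \<longrightarrow> i < n \<longrightarrow>
        Vector_Spaces.linear scale scale (\<lambda>x. g (as[i := x])))"

context triassociative_algebra
begin

fun product :: "trias_symbol \<Rightarrow> 'a \<Rightarrow> 'a \<Rightarrow> 'a" where
  "product Dashv = L"
| "product Vdash = R"
| "product Perp = M"

definition cochains :: "nat \<Rightarrow> 'a cochain set" where
  "cochains n = {f.
     (\<forall>\<psi>\<in>trees n. multilinear_list scale n (f \<psi>)) \<and>
     (\<forall>\<psi> as. \<not> (\<psi> \<in> trees n \<and> length as = n) \<longrightarrow> f \<psi> as = 0)}"

definition coface :: "nat \<Rightarrow> nat \<Rightarrow> 'a cochain \<Rightarrow> 'a cochain" where
  "coface n i f = (\<lambda>\<psi> as.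
     if \<psi> \<in> trees (n + 1) \<and> length as = n + 1 then
       (if i = 0 then
          product (circ_symbol \<psi> 0) (hd as) (f (del_leaf 0 \<psi>) (tl as))
        else if i = n + 1 then
          product (circ_symbol \<psi> (n + 1)) (f (del_leaf (n + 1) \<psi>) (butlast as)) (last as)
        else
          f (del_leaf i \<psi>)
            (take (i - 1) as @ [product (circ_symbol \<psi> i) (as ! (i - 1)) (as ! i)]
              @ drop (i + 1) as))
     else 0)"

definition coboundary :: "nat \<Rightarrow> 'a cochain \<Rightarrow> 'a cochain" where
  "coboundary n f = (\<lambda>\<psi> as. \<Sum>i = 0..n + 1. scale ((- 1) ^ i) (coface n i f \<psi> as))"

definition cocycles :: "nat \<Rightarrow> 'a cochain set" where
  "cocycles n = {f \<in> cochains n. coboundary n f = (\<lambda>\<psi> as. 0)}"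

definition coboundaries :: "nat \<Rightarrow> 'a cochain set" where
  "coboundaries n = (case n of 0 \<Rightarrow> {\<lambda>\<psi> as. 0} | Suc m \<Rightarrow> coboundary m ` cochains m)"

definition cohomologous :: "nat \<Rightarrow> ('a cochain \<times> 'a cochain) set" where
  "cohomologous n = {(f, g). f \<in> cocycles n \<and> g \<in> cocycles n \<and>
     (\<lambda>\<psi> as. f \<psi> as - g \<psi> as) \<in> coboundaries n}"

definition cohomology :: "nat \<Rightarrow> 'a cochain set set" where
  "cohomology n = cocycles n // cohomologous n"

text \<open>The set \<open>coboundaries n\<close> is the zero class of the quotient \<open>cohomology n\<close>.\<close>

definition cohomology_trivial :: "nat \<Rightarrow> bool" where
  "cohomology_trivial n \<longleftrightarrow> cohomology n = {coboundaries n}"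

end

definition lambda_of :: "'a cochain \<Rightarrow> 'a \<Rightarrow> 'a \<Rightarrow> 'a" where
  "lambda_of \<theta> x y = \<theta> (Graft [Lf, Graft [Lf, Lf]]) [x, y]"

definition rho_of :: "'a cochain \<Rightarrow> 'a \<Rightarrow> 'a \<Rightarrow> 'a" where
  "rho_of \<theta> x y = \<theta> (Graft [Graft [Lf, Lf], Lf]) [x, y]"

definition mu_of :: "'a cochain \<Rightarrow> 'a \<Rightarrow> 'a \<Rightarrow> 'a" where
  "mu_of \<theta> x y = \<theta> (Graft [Lf, Lf, Lf]) [x, y]"

text \<open>
  The operation \<open>\<Sum>\<^sub>i B\<^sub>i t\<^sup>i\<close> extended to power series with coefficients in \<open>A\<close>:
  the coefficient of \<open>t\<^sup>n\<close> is the sum of all \<open>B\<^sub>i(u\<^sub>j, v\<^sub>k)\<close> with \<open>i + j + k = n\<close>.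
\<close>

definition series_operation ::
  "(nat \<Rightarrow> 'a \<Rightarrow> 'a \<Rightarrow> 'a::ab_group_add) \<Rightarrow> 'a fps \<Rightarrow> 'a fps \<Rightarrow> 'a fps" where
  "series_operation B u v =
     Abs_fps (\<lambda>n. \<Sum>i = 0..n. \<Sum>j = 0..n - i. B i (fps_nth u j) (fps_nth v (n - i - j)))"

context triassociative_algebra
begin

text \<open>
  The power series \<open>\<Sum>\<^sub>i \<theta>\<^sub>i t\<^sup>i\<close> is given by its sequence of coefficients.  Elements \<open>x\<close> of \<open>A\<close> are
  regarded as constant power series.
\<close>

definition deformation :: "(nat \<Rightarrow> 'a cochain) \<Rightarrow> bool" where
  "deformation \<Theta> \<longleftrightarrow>
     (\<forall>i. \<Theta> i \<in> cochains 2) \<and>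
     lambda_of (\<Theta> 0) = L \<and> rho_of (\<Theta> 0) = R \<and> mu_of (\<Theta> 0) = M \<and>
     (\<forall>x y z. trias_identities
        (series_operation (\<lambda>i. lambda_of (\<Theta> i)))
        (series_operation (\<lambda>i. rho_of (\<Theta> i)))
        (series_operation (\<lambda>i. mu_of (\<Theta> i)))
        (fps_const x) (fps_const y) (fps_const z))"

end

definition infinitesimal :: "(nat \<Rightarrow> 'a cochain) \<Rightarrow> 'a cochain" where
  "infinitesimal \<Theta> = \<Theta> 1"

end

theory Submission imports Defs begin

text \<open>
  Deleting leaves restricts a tree \<open>\<psi>\<close> to a subset of its leaves, and \<open>\<circ>\<^sub>i\<^sup>\<psi>\<close> is the middle
  symbol of the restriction of \<open>\<psi>\<close> to three leaves: \<open>0, 1, n + 1\<close> for \<open>i = 0\<close>, \<open>i - 1, i, i + 1\<close>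
  for \<open>1 \<le> i \<le> n\<close>, and \<open>0, n, n + 1\<close> for \<open>i = n + 1\<close>.  Hence the cochains carry Gerstenhaber's
  circle product, and with \<open>\<pi> = (\<stileturn>, \<turnstile>, \<bottom>)\<close> the coboundary is \<open>f \<mapsto> -(\<pi> \<circ> f + f \<circ> \<pi>)\<close> in degree
  \<open>2\<close> and \<open>f \<mapsto> \<pi> \<circ> f - f \<circ> \<pi>\<close> in degree \<open>3\<close>.  The series \<open>\<Theta> = \<Sum>\<^sub>i \<theta>\<^sub>i t\<^sup>i\<close> is a deformation iff
  \<open>\<Theta> \<circ> \<Theta> = 0\<close>.  Since \<open>\<Theta> \<circ> (\<Theta> \<circ> \<Theta>) = (\<Theta> \<circ> \<Theta>) \<circ> \<Theta>\<close> for every series, the lowest nonzero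
  coefficient of \<open>\<Theta> \<circ> \<Theta>\<close> is a \<open>3\<close>-cocycle; as it is a coboundary, it can be removed by changing
  the corresponding \<open>\<theta>\<^sub>n\<close>.
\<close>

section \<open>Enumeration of trees with few leaves\<close>

text \<open>The index counts leaves, so a single tree of \<open>trees n\<close>, viewed as a forest,
  lies in \<open>forests (n + 1)\<close>.\<close>

definition forests :: "nat \<Rightarrow> ptree list set" where
  "forests n = {ts. (\<forall>t\<in>set ts. reduced t) \<and> sum_list (map leaves ts) = n}"

lemma leaves_pos: "reduced t \<Longrightarrow> 0 < leaves t"
proof (induction t rule: reduced.induct)
  case (2 ts)
  then obtain t where "t \<in> set ts"
    by (cases ts) auto
  with 2 have "0 < leaves t" by auto
  with \<open>t \<in> set ts\<close> show ?case
    by (metis elem_le_sum_list leaves.simps(2) in_set_conv_nth length_map nth_map gr0I le_zero_eq less_numeral_extra(3))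
qed simp

lemma forests_0: "forests 0 = {[]}"
proof -
  have "ts = []" if "ts \<in> forests 0" for ts
    using that by (cases ts) (auto simp: forests_def dest: leaves_pos)
  then show ?thesis by (auto simp: forests_def)
qed

lemma forests_Cons_iff:
  "t # ts \<in> forests (Suc n) \<longleftrightarrow> (\<exists>m\<le>n. t \<in> trees m \<and> ts \<in> forests (n - m))"
proof
  assume "t # ts \<in> forests (Suc n)"
  then have "t \<in> trees (leaves t - 1) \<and> ts \<in> forests (n - (leaves t - 1)) \<and> leaves t - 1 \<le> n"
    using leaves_pos[of t] by (auto simp: forests_def trees_def)
  then show "\<exists>m\<le>n. t \<in> trees m \<and> ts \<in> forests (n - m)" by blast
qed (auto simp: forests_def trees_def)

lemma ball_forests_Suc:
  "(\<forall>ts\<in>forests (Suc n). P ts) \<longleftrightarrow> (\<forall>m\<in>{..n}. \<forall>t\<in>trees m. \<forall>ts\<in>forests (n - m). P (t # ts))"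
proof -
  have "[] \<notin> forests (Suc n)" by (simp add: forests_def)
  then have "(\<forall>ts\<in>forests (Suc n). P ts) \<longleftrightarrow> (\<forall>t ts. t # ts \<in> forests (Suc n) \<longrightarrow> P (t # ts))"
    by (metis list.exhaust)
  then show ?thesis by (auto simp: forests_Cons_iff)
qed

lemma trees_0: "trees 0 = {Lf}"
proof -
  have "t = Lf" if "t \<in> trees 0" for t
  proof (cases t)
    case (Graft ts)
    with that obtain a b us where "ts = a # b # us" "0 < leaves a" "0 < leaves b"
      using leaves_pos by (auto simp: trees_def Suc_le_length_iff numeral_2_eq_2)
    with that Graft show ?thesis by (auto simp: trees_def)
  qed
  then show ?thesis by (auto simp: trees_def)
qed

text \<open>The bound \<open>m \<le> n\<close> encodes that at least two trees are grafted: it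
  leaves \<open>Suc n - m > 0\<close> leaves for the remaining forest, which is therefore
  nonempty.\<close>

lemma Graft_in_trees_Suc_iff:
  "Graft ts \<in> trees (Suc n) \<longleftrightarrow>
     (\<exists>m\<le>n. \<exists>t\<in>trees m. \<exists>us\<in>forests (Suc n - m). ts = t # us)"
proof
  assume *: "Graft ts \<in> trees (Suc n)"
  then obtain t u us where ts: "ts = t # u # us"
    by (auto simp: trees_def Suc_le_length_iff numeral_2_eq_2)
  with * have "ts \<in> forests (Suc (Suc n))" by (auto simp: trees_def forests_def)
  with ts obtain m where m: "m \<le> Suc n" "t \<in> trees m" "u # us \<in> forests (Suc n - m)"
    by (auto simp: forests_Cons_iff)
  then have "m \<noteq> Suc n" by (auto simp: forests_0)
  with m ts show "\<exists>m\<le>n. \<exists>t\<in>trees m. \<exists>us\<in>forests (Suc n - m). ts = t # us"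
    by (metis le_SucE)
next
  assume "\<exists>m\<le>n. \<exists>t\<in>trees m. \<exists>us\<in>forests (Suc n - m). ts = t # us"
  then obtain m t us where "m \<le> n" "t \<in> trees m" "us \<in> forests (Suc n - m)" "ts = t # us"
    by blast
  then show "Graft ts \<in> trees (Suc n)"
    by (cases us) (auto simp: trees_def forests_def)
qed

lemma ball_trees_Suc:
  "(\<forall>\<psi>\<in>trees (Suc n). P \<psi>) \<longleftrightarrow>
     (\<forall>m\<in>{..n}. \<forall>t\<in>trees m. \<forall>ts\<in>forests (Suc n - m). P (Graft (t # ts)))"
proof -
  have "Lf \<notin> trees (Suc n)" by (simp add: trees_def)
  then have "(\<forall>\<psi>\<in>trees (Suc n). P \<psi>) \<longleftrightarrow> (\<forall>ts. Graft ts \<in> trees (Suc n) \<longrightarrow> P (Graft ts))"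
    by (metis ptree.exhaust)
  then show ?thesis by (auto simp: Graft_in_trees_Suc_iff)
qed

text \<open>Used as rewrite rules, these turn a quantifier over \<open>trees 3\<close> or
  \<open>trees 4\<close> into a conjunction over 11 or 45 explicit trees.\<close>

lemmas tree_enumeration = ball_trees_Suc ball_forests_Suc trees_0 forests_0 eval_nat_numeral atMost_Suc

lemmas tree_evaluation = trees_def tree_degree_def leaf_orientation_def child_orientation_def
  eval_nat_numeral atMost_Suc

section \<open>Symbols and faces in degrees 2 to 4\<close>

text \<open>On \<open>trees 2\<close> this symbol tells the three trees apart: it names the product
  that the tree indexes.\<close>

abbreviation middle_symbol :: "ptree \<Rightarrow> trias_symbol" where
  "middle_symbol \<psi> \<equiv> circ_symbol \<psi> 1"

text \<open>Verified tree by tree. The deleted leaf is the one left out of the three on which the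
  symbol depends.\<close>

lemma faces_trees_3:
  assumes "\<psi> \<in> trees 3"
  shows "\<forall>i\<in>{..3}. del_leaf i \<psi> \<in> trees 2" (is "?A \<psi>")
    and "circ_symbol \<psi> 0 = middle_symbol (del_leaf 2 \<psi>)" (is "?B \<psi>")
    and "circ_symbol \<psi> 1 = middle_symbol (del_leaf 3 \<psi>)" (is "?C \<psi>")
    and "circ_symbol \<psi> 2 = middle_symbol (del_leaf 0 \<psi>)" (is "?D \<psi>")
    and "circ_symbol \<psi> 3 = middle_symbol (del_leaf 1 \<psi>)" (is "?E \<psi>")
proof -
  \<comment> \<open>Folding the claims into \<open>P\<close> lets the quantifier be expanded over
    all trees before any face or symbol is evaluated.\<close>
  define P where "P \<psi> \<longleftrightarrow> ?A \<psi> \<and> ?B \<psi> \<and> ?C \<psi> \<and> ?D \<psi> \<and> ?E \<psi>" for \<psi>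
  have "\<forall>\<psi>\<in>trees 3. P \<psi>"
    by (simp add: tree_enumeration, intro conjI; simp add: P_def tree_evaluation)
  with assms have "P \<psi>" by blast
  then show "?A \<psi>" "?B \<psi>" "?C \<psi>" "?D \<psi>" "?E \<psi>"
    unfolding P_def by blast+
qed

text \<open>Again by enumeration. In the numbering of \<open>\<psi>\<close>, the double faces in the
  last five claims delete the leaves 2, 3; then 3, 4; then 0, 4; then 0, 1; then 1, 2. The second
  claim is the simplicial identity.\<close>

lemma faces_trees_4:
  assumes "\<psi> \<in> trees 4"
  shows "\<forall>i\<in>{..4}. del_leaf i \<psi> \<in> trees 3" (is "?A \<psi>")
    and "\<forall>i\<in>{..3}. \<forall>j\<in>{..i}. del_leaf i (del_leaf j \<psi>) = del_leaf j (del_leaf (Suc i) \<psi>)" (is "?B \<psi>")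
    and "circ_symbol \<psi> 0 = middle_symbol (del_leaf 2 (del_leaf 2 \<psi>))" (is "?C \<psi>")
    and "circ_symbol \<psi> 1 = middle_symbol (del_leaf 3 (del_leaf 4 \<psi>))" (is "?D \<psi>")
    and "circ_symbol \<psi> 2 = middle_symbol (del_leaf 0 (del_leaf 4 \<psi>))" (is "?E \<psi>")
    and "circ_symbol \<psi> 3 = middle_symbol (del_leaf 0 (del_leaf 0 \<psi>))" (is "?F \<psi>")
    and "circ_symbol \<psi> 4 = middle_symbol (del_leaf 1 (del_leaf 1 \<psi>))" (is "?G \<psi>")
proof -
  define P where "P \<psi> \<longleftrightarrow> ?A \<psi> \<and> ?B \<psi> \<and> ?C \<psi> \<and> ?D \<psi> \<and> ?E \<psi> \<and> ?F \<psi> \<and> ?G \<psi>" for \<psi>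
  have "\<forall>\<psi>\<in>trees 4. P \<psi>"
    by (simp add: tree_enumeration, intro conjI; simp add: P_def tree_evaluation)
  with assms have "P \<psi>" by blast
  then show "?A \<psi>" "?B \<psi>" "?C \<psi>" "?D \<psi>" "?E \<psi>" "?F \<psi>" "?G \<psi>"
    unfolding P_def by blast+
qed

section \<open>Circle product of 2-cochains\<close>

text \<open>Place \<open>as ! i\<close> in the gap between leaves \<open>i\<close> and
  \<open>i + 1\<close>. The inner cochain sees the three leaves bordering its two arguments; the
  outer one sees all leaves but the one between these arguments.\<close>

definition circle :: "'a::ab_group_add cochain \<Rightarrow> 'a cochain \<Rightarrow> 'a cochain" where
  "circle f g = (\<lambda>\<psi> as.
     if \<psi> \<in> trees 3 \<and> length as = 3 then
       f (del_leaf 1 \<psi>) [g (del_leaf 3 \<psi>) [as ! 0, as ! 1], as ! 2] -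
       f (del_leaf 2 \<psi>) [as ! 0, g (del_leaf 0 \<psi>) [as ! 1, as ! 2]]
     else 0)"

text \<open>This is the coefficient of \<open>t^n\<close> in \<Theta> \<circ> \<Theta>.\<close>

definition circle_square :: "(nat \<Rightarrow> 'a::ab_group_add cochain) \<Rightarrow> nat \<Rightarrow> 'a cochain" where
  "circle_square \<Theta> n = (\<lambda>\<psi> as. \<Sum>i = 0..n. circle (\<Theta> i) (\<Theta> (n - i)) \<psi> as)"

lemma circle_apply:
  "\<psi> \<in> trees 3 \<Longrightarrow> circle f g \<psi> [x, y, z] =
     f (del_leaf 1 \<psi>) [g (del_leaf 3 \<psi>) [x, y], z] -
     f (del_leaf 2 \<psi>) [x, g (del_leaf 0 \<psi>) [y, z]]"
  by (simp add: circle_def numeral_2_eq_2 numeral_3_eq_3)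

lemma circle_outside: "\<not> (\<psi> \<in> trees 3 \<and> length as = 3) \<Longrightarrow> circle f g \<psi> as = 0"
  by (auto simp: circle_def)

lemma circle_square_outside:
  "\<not> (\<psi> \<in> trees 3 \<and> length as = 3) \<Longrightarrow> circle_square \<Theta> n \<psi> as = 0"
  by (auto simp: circle_square_def circle_outside)

section \<open>Multilinearity of cochains\<close>

lemma length_eq_2E: "length as = 2 \<Longrightarrow> (\<And>a b. as = [a, b] \<Longrightarrow> thesis) \<Longrightarrow> thesis"
  by (auto simp: length_Suc_conv eval_nat_numeral)

lemma length_eq_3E: "length as = 3 \<Longrightarrow> (\<And>a b c. as = [a, b, c] \<Longrightarrow> thesis) \<Longrightarrow> thesis"
  by (auto simp: length_Suc_conv eval_nat_numeral)

lemma length_eq_4E: "length as = 4 \<Longrightarrow> (\<And>a b c d. as = [a, b, c, d] \<Longrightarrow> thesis) \<Longrightarrow> thesis"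
  by (auto simp: length_Suc_conv eval_nat_numeral)

lemma multilinear_list_2_iff:
  "multilinear_list scale 2 g \<longleftrightarrow>
     (\<forall>a b. Vector_Spaces.linear scale scale (\<lambda>x. g [x, b]) \<and>
            Vector_Spaces.linear scale scale (\<lambda>x. g [a, x]))"
  (is "?l \<longleftrightarrow> ?r")
proof
  assume l: ?l
  have "Vector_Spaces.linear scale scale (\<lambda>x. g [x, b])"
    "Vector_Spaces.linear scale scale (\<lambda>x. g [a, x])" for a b
    using l[unfolded multilinear_list_def, rule_format, of "[0, b]" 0]
      l[unfolded multilinear_list_def, rule_format, of "[a, 0]" 1] by simp_all
  then show ?r by simp
qed (auto simp: multilinear_list_def less_2_cases_iff elim!: length_eq_2E)

lemma multilinear_list_3I:
  assumes "\<And>a b c. Vector_Spaces.linear scale scale (\<lambda>x. g [x, b, c])"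
    "\<And>a b c. Vector_Spaces.linear scale scale (\<lambda>x. g [a, x, c])"
    "\<And>a b c. Vector_Spaces.linear scale scale (\<lambda>x. g [a, b, x])"
  shows "multilinear_list scale 3 g"
  unfolding multilinear_list_def
proof (intro allI impI)
  fix as :: "'b list" and i :: nat
  assume "length as = 3" and i: "i < 3"
  from \<open>length as = 3\<close> obtain a b c where "as = [a, b, c]" by (rule length_eq_3E)
  moreover from i have "i = 0 \<or> i = 1 \<or> i = 2" by linarith
  ultimately show "Vector_Spaces.linear scale scale (\<lambda>x. g (as[i := x]))"
    using assms by (auto simp: numeral_2_eq_2)
qed

context triassociative_algebra
begin

text \<open>Outside \<open>trees 2\<close> a cochain is zero and hence linear in each argument as
  well, so the rewrite rules derived from this apply at every tree.\<close>

lemma cochains_2_linear: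
  assumes "f \<in> cochains 2"
  shows "Vector_Spaces.linear scale scale (\<lambda>x. f \<psi> [x, b])"
    and "Vector_Spaces.linear scale scale (\<lambda>x. f \<psi> [a, x])"
proof -
  have "Vector_Spaces.linear scale scale (\<lambda>x. f \<psi> [x, b]) \<and>
    Vector_Spaces.linear scale scale (\<lambda>x. f \<psi> [a, x])"
  proof (cases "\<psi> \<in> trees 2")
    case True
    with assms show ?thesis by (auto simp: cochains_def multilinear_list_2_iff)
  next
    case False
    with assms have "f \<psi> as = 0" for as by (auto simp: cochains_def)
    then show ?thesis by (simp add: Vector_Spaces.linear_iff vector_space_axioms)
  qed
  then show "Vector_Spaces.linear scale scale (\<lambda>x. f \<psi> [x, b])"
    "Vector_Spaces.linear scale scale (\<lambda>x. f \<psi> [a, x])" by auto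
qed

lemma cochains_2_simps:
  assumes "f \<in> cochains 2"
  shows "f \<psi> [x + y, b] = f \<psi> [x, b] + f \<psi> [y, b]"
    and "f \<psi> [a, x + y] = f \<psi> [a, x] + f \<psi> [a, y]"
    and "f \<psi> [scale c x, b] = scale c (f \<psi> [x, b])"
    and "f \<psi> [a, scale c x] = scale c (f \<psi> [a, x])"
    and "f \<psi> [0, b] = 0"
    and "f \<psi> [a, 0] = 0"
    and "f \<psi> [x - y, b] = f \<psi> [x, b] - f \<psi> [y, b]"
    and "f \<psi> [a, x - y] = f \<psi> [a, x] - f \<psi> [a, y]"
    and "f \<psi> [sum h S, b] = (\<Sum>i\<in>S. f \<psi> [h i, b])"
    and "f \<psi> [a, sum h S] = (\<Sum>i\<in>S. f \<psi> [a, h i])"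
proof -
  interpret l: Vector_Spaces.linear scale scale "\<lambda>x. f \<psi> [x, b]"
    by (rule cochains_2_linear[OF assms])
  interpret r: Vector_Spaces.linear scale scale "\<lambda>x. f \<psi> [a, x]"
    by (rule cochains_2_linear[OF assms])
  show "f \<psi> [x + y, b] = f \<psi> [x, b] + f \<psi> [y, b]"
    "f \<psi> [scale c x, b] = scale c (f \<psi> [x, b])"
    "f \<psi> [0, b] = 0"
    "f \<psi> [x - y, b] = f \<psi> [x, b] - f \<psi> [y, b]"
    "f \<psi> [sum h S, b] = (\<Sum>i\<in>S. f \<psi> [h i, b])"
    by (rule l.add l.scale l.zero l.diff l.sum)+
  show "f \<psi> [a, x + y] = f \<psi> [a, x] + f \<psi> [a, y]"
    "f \<psi> [a, scale c x] = scale c (f \<psi> [a, x])"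
    "f \<psi> [a, 0] = 0"
    "f \<psi> [a, x - y] = f \<psi> [a, x] - f \<psi> [a, y]"
    "f \<psi> [a, sum h S] = (\<Sum>i\<in>S. f \<psi> [a, h i])"
    by (rule r.add r.scale r.zero r.diff r.sum)+
qed

lemma zero_in_cochains: "(\<lambda>\<psi> as. 0) \<in> cochains n"
  by (simp add: cochains_def multilinear_list_def Vector_Spaces.linear_iff vector_space_axioms)

lemma circle_square_in_cochains:
  assumes "\<And>i. \<Theta> i \<in> cochains 2"
  shows "circle_square \<Theta> n \<in> cochains 3"
proof -
  note [simp] = cochains_2_simps[OF assms]
  have "multilinear_list scale 3 (circle_square \<Theta> n \<psi>)" if "\<psi> \<in> trees 3" for \<psi>
    by (rule multilinear_list_3I)
      (simp_all add: Vector_Spaces.linear_iff vector_space_axioms circle_square_def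
        circle_apply[OF that] scale_sum_right scale_right_diff_distrib algebra_simps
        flip: sum.distrib)
  then show ?thesis
    by (auto simp: cochains_def circle_square_outside)
qed

section \<open>The structure cochain and the coboundary in degrees 2 and 3\<close>

text \<open>The cochain \<pi> formed by the three products.\<close>

definition product_cochain :: "'a cochain" where
  "product_cochain = (\<lambda>\<psi> as.
     if \<psi> \<in> trees 2 \<and> length as = 2 then product (middle_symbol \<psi>) (as ! 0) (as ! 1) else 0)"

lemma product_cochain_apply:
  "\<psi> \<in> trees 2 \<Longrightarrow> product_cochain \<psi> [x, y] = product (middle_symbol \<psi>) x y"
  by (simp add: product_cochain_def)

lemma product_linear:
  "Vector_Spaces.linear scale scale (\<lambda>x. product s x b)"
  "Vector_Spaces.linear scale scale (\<lambda>x. product s a x)"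
  using bilinear_L bilinear_R bilinear_M by (cases s; simp add: bilinear_operation_def)+

lemma product_cochain_in_cochains: "product_cochain \<in> cochains 2"
  by (auto simp: cochains_def product_cochain_apply multilinear_list_2_iff product_linear)
    (auto simp: product_cochain_def)

text \<open>The eleven trees of \<open>trees 3\<close> give the eleven triassociative identities,
  one each.\<close>

lemma circle_product_cochain: "circle product_cochain product_cochain = (\<lambda>\<psi> as. 0)"
proof (intro ext)
  fix \<psi> and as :: "'a list"
  define P where "P \<psi> \<longleftrightarrow> (\<forall>x y z.
    product (middle_symbol (del_leaf 1 \<psi>)) (product (middle_symbol (del_leaf 3 \<psi>)) x y) z =
    product (middle_symbol (del_leaf 2 \<psi>)) x (product (middle_symbol (del_leaf 0 \<psi>)) y z))" for \<psi>
  have P: "\<forall>\<psi>\<in>trees 3. P \<psi>"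
    using identities[unfolded trias_identities_def]
    by (simp add: tree_enumeration, intro conjI; simp add: P_def tree_evaluation)
  show "circle product_cochain product_cochain \<psi> as = 0"
  proof (cases "\<psi> \<in> trees 3 \<and> length as = 3")
    case True
    then obtain x y z where as: "as = [x, y, z]" by (auto elim: length_eq_3E)
    have "del_leaf i \<psi> \<in> trees 2" if "i \<le> 3" for i
      using faces_trees_3(1) True that by auto
    with True P show ?thesis
      by (simp add: as circle_apply product_cochain_apply P_def)
  qed (rule circle_outside)
qed

text \<open>By \<open>faces_trees_3\<close> each symbol is the middle symbol of a face, so every
  product is a value of \<pi>. The cofaces 0 and 3 then add up to -(\<pi> \<circ> f), the cofaces 1
  and 2 to -(f \<circ> \<pi>).\<close>

lemma coboundary_2:
  assumes "f \<in> cochains 2"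
  shows "coboundary 2 f \<psi> as = - (circle product_cochain f \<psi> as + circle f product_cochain \<psi> as)"
proof (cases "\<psi> \<in> trees 3 \<and> length as = 3")
  case True
  then obtain x y z where as: "as = [x, y, z]" by (auto elim: length_eq_3E)
  from True have \<psi>: "\<psi> \<in> trees 3" by simp
  have faces: "del_leaf i \<psi> \<in> trees 2" if "i \<le> 3" for i
    using faces_trees_3(1)[OF \<psi>] that by auto
  show ?thesis
    using faces_trees_3(2-5)[OF \<psi>] \<psi> faces[of 0] faces[of 1] faces[of 2] faces[of 3]
    by (simp add: as coboundary_def coface_def circle_apply product_cochain_apply eval_nat_numeral)
next
  case False
  then show ?thesis
    by (auto simp: coboundary_def coface_def circle_outside)
qed

text \<open>The products are written as values of \<pi> at double faces, the form in which they
  arise from \<open>circle_square_associator\<close>.\<close>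

lemma coboundary_3:
  assumes \<psi>: "\<psi> \<in> trees 4"
  shows "coboundary 3 F \<psi> [a, b, c, d] =
    product_cochain (del_leaf 2 (del_leaf 2 \<psi>)) [a, F (del_leaf 0 \<psi>) [b, c, d]]
    - F (del_leaf 1 \<psi>) [product_cochain (del_leaf 3 (del_leaf 4 \<psi>)) [a, b], c, d]
    + F (del_leaf 2 \<psi>) [a, product_cochain (del_leaf 0 (del_leaf 4 \<psi>)) [b, c], d]
    - F (del_leaf 3 \<psi>) [a, b, product_cochain (del_leaf 0 (del_leaf 0 \<psi>)) [c, d]]
    + product_cochain (del_leaf 1 (del_leaf 1 \<psi>)) [F (del_leaf 4 \<psi>) [a, b, c], d]"
proof -
  have faces: "del_leaf i (del_leaf j \<psi>) \<in> trees 2" if "i \<le> 3" "j \<le> 4" for i j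
    using faces_trees_4(1)[OF \<psi>] faces_trees_3(1) that by auto
  show ?thesis
    using faces_trees_4(3-7)[OF \<psi>] \<psi>
      faces[of 2 2] faces[of 3 4] faces[of 0 4] faces[of 0 0] faces[of 1 1]
    by (simp add: coboundary_def coface_def product_cochain_apply eval_nat_numeral)
qed

section \<open>The obstruction cocycle\<close>

text \<open>Coefficient \<open>n\<close> of \<Theta> \<circ> (\<Theta> \<circ> \<Theta>) = (\<Theta>
  \<circ> \<Theta>) \<circ> \<Theta>. The two sides are compared directly, without division by 2, so
  the identity holds in every characteristic.\<close>

lemma circle_square_associator:
  assumes \<Theta>: "\<And>i. \<Theta> i \<in> cochains 2" and \<psi>: "\<psi> \<in> trees 4"
  shows "(\<Sum>i = 0..n.
      \<Theta> i (del_leaf 1 (del_leaf 1 \<psi>)) [circle_square \<Theta> (n - i) (del_leaf 4 \<psi>) [a, b, c], d] +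
      \<Theta> i (del_leaf 2 (del_leaf 2 \<psi>)) [a, circle_square \<Theta> (n - i) (del_leaf 0 \<psi>) [b, c, d]]) =
    (\<Sum>j = 0..n.
      circle_square \<Theta> j (del_leaf 1 \<psi>) [\<Theta> (n - j) (del_leaf 3 (del_leaf 4 \<psi>)) [a, b], c, d] -
      circle_square \<Theta> j (del_leaf 2 \<psi>) [a, \<Theta> (n - j) (del_leaf 0 (del_leaf 4 \<psi>)) [b, c], d] +
      circle_square \<Theta> j (del_leaf 3 \<psi>) [a, b, \<Theta> (n - j) (del_leaf 0 (del_leaf 0 \<psi>)) [c, d]])"
    (is "?l = ?r")
proof -
  let ?X = "\<lambda>i j k.
    \<Theta> i (del_leaf 1 (del_leaf 1 \<psi>)) [circle (\<Theta> j) (\<Theta> k) (del_leaf 4 \<psi>) [a, b, c], d] +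
    \<Theta> i (del_leaf 2 (del_leaf 2 \<psi>)) [a, circle (\<Theta> j) (\<Theta> k) (del_leaf 0 \<psi>) [b, c, d]]"
  let ?Y = "\<lambda>i j k.
    circle (\<Theta> i) (\<Theta> j) (del_leaf 1 \<psi>) [\<Theta> k (del_leaf 3 (del_leaf 4 \<psi>)) [a, b], c, d] -
    circle (\<Theta> i) (\<Theta> j) (del_leaf 2 \<psi>) [a, \<Theta> k (del_leaf 0 (del_leaf 4 \<psi>)) [b, c], d] +
    circle (\<Theta> i) (\<Theta> j) (del_leaf 3 \<psi>) [a, b, \<Theta> k (del_leaf 0 (del_leaf 0 \<psi>)) [c, d]]"
  let ?Z = "\<lambda>i j k. \<Theta> i (del_leaf 1 (del_leaf 3 \<psi>))
    [\<Theta> j (del_leaf 3 (del_leaf 4 \<psi>)) [a, b], \<Theta> k (del_leaf 0 (del_leaf 0 \<psi>)) [c, d]]"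
  note simps = cochains_2_simps[OF \<Theta>]
  have faces: "del_leaf i \<psi> \<in> trees 3" if "i \<le> 4" for i
    using faces_trees_4(1)[OF \<psi>] that by auto
  have comm: "del_leaf i (del_leaf j \<psi>) = del_leaf j (del_leaf (Suc i) \<psi>)" if "i \<le> 3" "j \<le> i" for i j
    using faces_trees_4(2)[OF \<psi>] that by auto
  have flip: "(\<Sum>j = 0..m. h (m - j) j) = (\<Sum>j = 0..m. h j (m - j))"
    for h :: "nat \<Rightarrow> nat \<Rightarrow> 'a" and m
    by (rule trans[OF sum.atLeastAtMost_rev]) (auto intro: sum.cong)
  text \<open>
    The surplus terms \<open>\<theta>\<^sub>i(\<theta>\<^sub>j(a, b), \<theta>\<^sub>k(c, d))\<close> occur with both signs, with \<open>j\<close> and \<open>k\<close>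
    exchanged, so they cancel after summation.
  \<close>
  have X_Y: "?X i j k = ?Y i j k + (?Z i k j - ?Z i j k)" for i j k
    using faces[of 0] faces[of 1] faces[of 2] faces[of 3] faces[of 4]
      comm[of 1 1] comm[of 3 1] comm[of 3 3] comm[of 3 2] comm[of 3 0] comm[of 1 0]
      comm[of 2 0] comm[of 0 0] comm[of 2 2] comm[of 2 1]
    by (simp add: circle_apply simps eval_nat_numeral)
  have "?l = (\<Sum>i = 0..n. \<Sum>j = 0..n - i. ?X i j (n - i - j))"
    by (simp add: circle_square_def simps sum.distrib)
  also have "\<dots> = (\<Sum>i = 0..n. \<Sum>j = 0..n - i. ?Y i j (n - i - j)) +
      (\<Sum>i = 0..n. (\<Sum>j = 0..n - i. ?Z i (n - i - j) j) - (\<Sum>j = 0..n - i. ?Z i j (n - i - j)))"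
    by (simp only: X_Y sum.distrib sum_subtractf)
  also have "\<dots> = (\<Sum>i = 0..n. \<Sum>j = 0..n - i. ?Y i j (n - i - j))"
    by (simp only: flip[where h = "?Z i" and m = "n - i" for i] diff_self sum.neutral_const add_0_right)
  \<comment> \<open>The triples of indices with sum \<open>n\<close> are now grouped by their last
    entry instead of their first, as in the associativity of power series multiplication.\<close>
  also have "\<dots> = (\<Sum>j = 0..n. \<Sum>i = 0..j. ?Y i (j - i) (n - j))"
    by (rule fps_mult_assoc_lemma[symmetric])
  also have "\<dots> = ?r"
    by (simp add: circle_square_def sum.distrib sum_subtractf)
  finally show ?thesis .
qed

text \<open>In \<open>circle_square_associator\<close> all summands but one on each side contain a
  lower coefficient of \<Theta> \<circ> \<Theta> and vanish. With F the coefficient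
  \<open>n\<close>, what remains is \<pi> \<circ> F = F \<circ> \<pi>, that is, F is a
  cocycle.\<close>

lemma coboundary_circle_square:
  assumes \<Theta>: "\<And>i. \<Theta> i \<in> cochains 2" and \<Theta>0: "\<Theta> 0 = product_cochain"
    and vanish: "\<And>m. m < n \<Longrightarrow> circle_square \<Theta> m = (\<lambda>\<psi> as. 0)"
  shows "coboundary 3 (circle_square \<Theta> n) = (\<lambda>\<psi> as. 0)"
proof (intro ext)
  fix \<psi> and as :: "'a list"
  show "coboundary 3 (circle_square \<Theta> n) \<psi> as = 0"
  proof (cases "\<psi> \<in> trees 4 \<and> length as = 4")
    case True
    then obtain a b c d where as: "as = [a, b, c, d]" by (auto elim: length_eq_4E)
    from True have \<psi>: "\<psi> \<in> trees 4" by simp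
    note simps = cochains_2_simps[OF \<Theta>]
    have low: "circle_square \<Theta> (n - i) = (\<lambda>\<psi> as. 0)" if "i \<in> {0..n} - {0}" for i
      using that by (intro vanish) auto
    have high: "circle_square \<Theta> i = (\<lambda>\<psi> as. 0)" if "i \<in> {0..n} - {n}" for i
      using that by (intro vanish) auto
    have collapse: "sum h {0..n} = h k" if "k \<le> n" "\<And>i. i \<in> {0..n} - {k} \<Longrightarrow> h i = 0"
      for h :: "nat \<Rightarrow> 'a" and k
      using that by (simp add: sum.remove[of "{0..n}" k])
    have "product_cochain (del_leaf 1 (del_leaf 1 \<psi>)) [circle_square \<Theta> n (del_leaf 4 \<psi>) [a, b, c], d] +
      product_cochain (del_leaf 2 (del_leaf 2 \<psi>)) [a, circle_square \<Theta> n (del_leaf 0 \<psi>) [b, c, d]] =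
      circle_square \<Theta> n (del_leaf 1 \<psi>) [product_cochain (del_leaf 3 (del_leaf 4 \<psi>)) [a, b], c, d] -
      circle_square \<Theta> n (del_leaf 2 \<psi>) [a, product_cochain (del_leaf 0 (del_leaf 4 \<psi>)) [b, c], d] +
      circle_square \<Theta> n (del_leaf 3 \<psi>) [a, b, product_cochain (del_leaf 0 (del_leaf 0 \<psi>)) [c, d]]"
      using circle_square_associator[where \<Theta> = \<Theta> and n = n, OF \<Theta> \<psi>, of a b c d]
      by (subst (asm) collapse[of 0], simp, simp add: low simps,
          subst (asm) collapse[of n], simp, simp add: high, simp add: \<Theta>0)
    then show ?thesis
      unfolding as coboundary_3[OF \<psi>] by (simp add: algebra_simps)
  next
    case False
    then show ?thesis
      by (auto simp: coboundary_def coface_def)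
  qed
qed

section \<open>Removing the obstruction\<close>

text \<open>As \<open>0 < n\<close>, the cochain \<open>r\<close> enters coefficient
  \<open>n\<close> only in the summands \<open>i = 0\<close> and \<open>i = n\<close>, each time
  paired with \<pi>. By \<open>coboundary_2\<close> the added term is minus the coboundary of
  \<open>r\<close>.\<close>

lemma circle_square_upd:
  assumes "r \<in> cochains 2" and \<Theta>0: "\<Theta> 0 = product_cochain" and n: "0 < n"
  shows "circle_square (\<Theta>(n := r)) n \<psi> as = circle_square (\<Theta>(n := (\<lambda>\<psi> as. 0))) n \<psi> as
    + (circle product_cochain r \<psi> as + circle r product_cochain \<psi> as)"
proof -
  have zero: "circle f (\<lambda>\<psi> as. 0) \<psi> as = 0" "circle (\<lambda>\<psi> as. 0) f \<psi> as = 0" if "f \<in> cochains 2" for f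
    using cochains_2_simps(5,6)[OF that] by (auto simp: circle_def)
  have "circle ((\<Theta>(n := r)) i) ((\<Theta>(n := r)) (n - i)) \<psi> as =
      circle ((\<Theta>(n := (\<lambda>\<psi> as. 0))) i) ((\<Theta>(n := (\<lambda>\<psi> as. 0))) (n - i)) \<psi> as +
      ((if i = 0 then circle product_cochain r \<psi> as else 0) +
       (if i = n then circle r product_cochain \<psi> as else 0))" if "i \<in> {0..n}" for i
    using that n \<Theta>0 zero[OF product_cochain_in_cochains] by auto
  then show ?thesis
    by (simp add: circle_square_def sum.distrib del: fun_upd_apply)
qed

text \<open>A cocycle lies in its own class because 0 is a coboundary, and triviality makes that
  class equal to \<open>coboundaries 3\<close>.\<close>

lemma cocycles_3_subset_coboundaries:
  assumes "cohomology_trivial 3"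
  shows "cocycles 3 \<subseteq> coboundaries 3"
proof
  fix f assume f: "f \<in> cocycles 3"
  have "(\<lambda>\<psi> as. 0) = coboundary 2 (\<lambda>\<psi> as. 0)"
    by (intro ext) (simp add: coboundary_2[OF zero_in_cochains] circle_def
      cochains_2_simps(5,6)[OF product_cochain_in_cochains])
  then have "(\<lambda>\<psi> as. 0) \<in> coboundaries 3"
    using zero_in_cochains[of 2] by (auto simp: coboundaries_def numeral_3_eq_3 numeral_2_eq_2)
  with f have "f \<in> cohomologous 3 `` {f}"
    by (simp add: cohomologous_def)
  moreover have "cohomologous 3 `` {f} \<in> cohomology 3"
    using f by (simp add: cohomology_def quotientI)
  then have "cohomologous 3 `` {f} = coboundaries 3"
    using assms by (simp add: cohomology_trivial_def)
  ultimately show "f \<in> coboundaries 3" by blast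
qed

text \<open>Only the coefficients below \<open>n\<close> are constrained, as they are all that is
  known at stage \<open>n\<close> of the recursion. The obstruction is the coboundary of some
  \<open>r\<close>, and inserting this \<open>r\<close> subtracts it.\<close>

lemma extend_circle_square:
  assumes trivial: "cohomology_trivial 3"
    and \<Theta>: "\<And>i. i < n \<Longrightarrow> \<Theta> i \<in> cochains 2" and \<Theta>0: "\<Theta> 0 = product_cochain" and n: "0 < n"
    and vanish: "\<And>m. m < n \<Longrightarrow> circle_square \<Theta> m = (\<lambda>\<psi> as. 0)"
  shows "\<exists>r\<in>cochains 2. circle_square (\<Theta>(n := r)) n = (\<lambda>\<psi> as. 0)"
proof -
  \<comment> \<open>Filling up with 0 from \<open>n\<close> on makes every coefficient a cochain;
    coefficient \<open>n\<close> of the square is then the obstruction.\<close>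
  define \<Theta>' where "\<Theta>' i = (if i < n then \<Theta> i else (\<lambda>\<psi> as. 0))" for i
  have \<Theta>': "\<Theta>' i \<in> cochains 2" for i
    by (simp add: \<Theta>'_def \<Theta> zero_in_cochains)
  have "circle_square \<Theta>' m = circle_square \<Theta> m" if "m < n" for m
    using that by (auto simp: circle_square_def \<Theta>'_def intro!: ext sum.cong)
  with vanish have "circle_square \<Theta>' m = (\<lambda>\<psi> as. 0)" if "m < n" for m
    using that by simp
  then have "coboundary 3 (circle_square \<Theta>' n) = (\<lambda>\<psi> as. 0)"
    using \<Theta>' \<Theta>0 n by (intro coboundary_circle_square) (simp_all add: \<Theta>'_def)
  then have "circle_square \<Theta>' n \<in> coboundaries 3"
    using cocycles_3_subset_coboundaries[OF trivial] circle_square_in_cochains[OF \<Theta>']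
    by (auto simp: cocycles_def)
  then obtain r where r: "r \<in> cochains 2" "circle_square \<Theta>' n = coboundary 2 r"
    by (auto simp: coboundaries_def numeral_3_eq_3 numeral_2_eq_2)
  have "circle_square (\<Theta>(n := (\<lambda>\<psi> as. 0))) n = circle_square \<Theta>' n"
    by (auto simp: circle_square_def \<Theta>'_def intro!: ext sum.cong)
  with r have "circle_square (\<Theta>(n := r)) n = (\<lambda>\<psi> as. 0)"
    by (intro ext) (simp add: circle_square_upd[where \<Theta> = \<Theta>, OF r(1) \<Theta>0 n] coboundary_2[OF r(1)]
      del: fun_upd_apply)
  with r show ?thesis by blast
qed

text \<open>Coefficient \<open>n\<close> involves no index above \<open>n\<close>. This is the
  congruence condition of the recursive choice below.\<close>

lemma circle_square_upd_cong:
  assumes "\<And>m. m < n \<Longrightarrow> f m = g m"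
  shows "circle_square (f(n := r)) n = circle_square (g(n := r)) n"
  using assms by (auto simp: circle_square_def intro!: ext sum.cong arg_cong2[where f = "\<lambda>x y. circle x y _ _"])

lemma vanishing_circle_square_exists:
  assumes trivial: "cohomology_trivial 3" and \<theta>: "\<theta> \<in> cocycles 2"
  obtains \<Theta> where "\<And>i. \<Theta> i \<in> cochains 2" "\<Theta> 0 = product_cochain" "\<Theta> 1 = \<theta>"
    "\<And>n. circle_square \<Theta> n = (\<lambda>\<psi> as. 0)"
proof -
  \<comment> \<open>\<open>P \<Theta> n r\<close> says that \<open>r\<close> may be chosen as
    coefficient \<open>n\<close> once those of \<open>\<Theta>\<close> below \<open>n\<close> are
    fixed.\<close>
  define P where "P \<Theta> n r \<longleftrightarrow> r \<in> cochains 2 \<and> (n = 0 \<longrightarrow> r = product_cochain) \<and>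
    (n = 1 \<longrightarrow> r = \<theta>) \<and> circle_square (\<Theta>(n := r)) n = (\<lambda>\<psi> as. 0)" for \<Theta> n r
  have "\<exists>\<Theta>. \<forall>n. P \<Theta> n (\<Theta> n)"
  proof (rule dependent_wellorder_choice)
    fix r :: "'a cochain" and f g :: "nat \<Rightarrow> 'a cochain" and n :: nat
    assume "\<And>m. m < n \<Longrightarrow> f m = g m"
    then show "P f n r = P g n r"
      unfolding P_def by (simp add: circle_square_upd_cong[of n f g])
  next
    fix n :: nat and f :: "nat \<Rightarrow> 'a cochain" assume *: "\<And>m. m < n \<Longrightarrow> P f m (f m)"
    then have f: "\<And>m. m < n \<Longrightarrow> f m \<in> cochains 2"
      "\<And>m. m < n \<Longrightarrow> circle_square f m = (\<lambda>\<psi> as. 0)" "0 < n \<Longrightarrow> f 0 = product_cochain"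
      by (auto simp: P_def)
    \<comment> \<open>For \<open>n = 0\<close> the square is \<pi> \<circ> \<pi> = 0, for
      \<open>n = 1\<close> it is minus the coboundary of \<open>\<theta>\<close>; the triviality of
      the cohomology enters from \<open>n = 2\<close> on.\<close>
    consider "n = 0" | "n = 1" | "1 < n" by linarith
    then show "\<exists>r. P f n r"
    proof cases
      case 1
      then show ?thesis
        by (auto simp: P_def circle_square_def circle_product_cochain product_cochain_in_cochains)
    next
      case 2
      from \<theta> have c: "\<theta> \<in> cochains 2" "coboundary 2 \<theta> = (\<lambda>\<psi> as. 0)" by (auto simp: cocycles_def)
      have "circle_square (f(n := \<theta>)) n \<psi> as = 0" for \<psi> as
        using coboundary_2[OF c(1), of \<psi> as] c(2) f(3) 2
        by (simp add: circle_square_def neg_eq_iff_add_eq_0)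
      with c 2 show ?thesis by (auto simp: P_def)
    next
      case 3
      with extend_circle_square[OF trivial, of n f] f show ?thesis by (auto simp: P_def)
    qed
  qed
  then obtain \<Theta> where "\<And>n. P \<Theta> n (\<Theta> n)" by blast
  then show ?thesis by (intro that[of \<Theta>]) (auto simp: P_def)
qed

end

section \<open>From the circle square to identities of power series\<close>

text \<open>Of each inner sum only \<open>j = n - i\<close> survives, where the constant series
  contributes its coefficient 0.\<close>

lemma series_operation_const_right:
  assumes "\<And>i x. B i x 0 = 0"
  shows "fps_nth (series_operation B u (fps_const z)) n = (\<Sum>i = 0..n. B i (fps_nth u (n - i)) z)"
proof -
  have "(\<Sum>j = 0..n - i. B i (fps_nth u j) (fps_nth (fps_const z) (n - i - j))) =
      (\<Sum>j = 0..n - i. if j = n - i then B i (fps_nth u (n - i)) z else 0)" for i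
    using assms by (intro sum.cong) auto
  then show ?thesis by (simp add: series_operation_def)
qed

lemma series_operation_const_left:
  assumes "\<And>i y. B i 0 y = 0"
  shows "fps_nth (series_operation B (fps_const x) v) n = (\<Sum>i = 0..n. B i x (fps_nth v (n - i)))"
proof -
  have "(\<Sum>j = 0..n - i. B i (fps_nth (fps_const x) j) (fps_nth v (n - i - j))) =
      (\<Sum>j = 0..n - i. if j = 0 then B i x (fps_nth v (n - i)) else 0)" for i
    using assms by (intro sum.cong) auto
  then show ?thesis by (simp add: series_operation_def)
qed

lemma series_operation_const:
  assumes "\<And>i x. B i x 0 = 0" "\<And>i y. B i 0 y = 0"
  shows "fps_nth (series_operation B (fps_const x) (fps_const y)) n = B n x y"
proof -
  have "(\<Sum>i = 0..n. B i (fps_nth (fps_const x) (n - i)) y) = (\<Sum>i = 0..n. if i = n then B n x y else 0)"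
    using assms by (intro sum.cong) auto
  then show ?thesis by (simp add: series_operation_const_right assms(1))
qed

context triassociative_algebra
begin

text \<open>At a fixed tree, \<open>circle_square \<Theta> n\<close> is the difference of the
  \<open>n\<close>th coefficients of two nested products of series, so its vanishing for all
  \<open>n\<close> is one identity per tree.\<close>

lemma deformation_if_circle_square_vanishes:
  assumes \<Theta>: "\<And>i. \<Theta> i \<in> cochains 2" and \<Theta>0: "\<Theta> 0 = product_cochain"
    and vanish: "\<And>n. circle_square \<Theta> n = (\<lambda>\<psi> as. 0)"
  shows "deformation \<Theta>"
proof -
  note simps = cochains_2_simps[OF \<Theta>]
  have key: "series_operation (\<lambda>i x y. \<Theta> i (del_leaf 1 \<psi>) [x, y])
        (series_operation (\<lambda>i x y. \<Theta> i (del_leaf 3 \<psi>) [x, y]) (fps_const x) (fps_const y)) (fps_const z) =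
      series_operation (\<lambda>i x y. \<Theta> i (del_leaf 2 \<psi>) [x, y]) (fps_const x)
        (series_operation (\<lambda>i x y. \<Theta> i (del_leaf 0 \<psi>) [x, y]) (fps_const y) (fps_const z))"
    if "\<psi> \<in> trees 3" for \<psi> x y z
  proof (rule fps_ext)
    fix n
    have "circle_square \<Theta> n \<psi> [x, y, z] = 0" by (simp add: vanish)
    then show "fps_nth (series_operation (\<lambda>i x y. \<Theta> i (del_leaf 1 \<psi>) [x, y])
        (series_operation (\<lambda>i x y. \<Theta> i (del_leaf 3 \<psi>) [x, y]) (fps_const x) (fps_const y)) (fps_const z)) n =
      fps_nth (series_operation (\<lambda>i x y. \<Theta> i (del_leaf 2 \<psi>) [x, y]) (fps_const x)
        (series_operation (\<lambda>i x y. \<Theta> i (del_leaf 0 \<psi>) [x, y]) (fps_const y) (fps_const z))) n"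
      \<comment> \<open>The instantiated rules match only operations with a nested argument; the
        inner ones, with two constant arguments, fall to
        \<open>series_operation_const\<close>.\<close>
      by (simp add: circle_square_def circle_apply[OF that] sum_subtractf simps
        series_operation_const
        series_operation_const_left[where v = "series_operation C u v" for C u v]
        series_operation_const_right[where u = "series_operation C u v" for C u v])
  qed
  have "trias_identities
      (series_operation (\<lambda>i. lambda_of (\<Theta> i)))
      (series_operation (\<lambda>i. rho_of (\<Theta> i)))
      (series_operation (\<lambda>i. mu_of (\<Theta> i))) (fps_const x) (fps_const y) (fps_const z)" for x y z
    unfolding trias_identities_def lambda_of_def rho_of_def mu_of_def
    \<comment> \<open>One tree per identity: faces 1 and 3 pick the outer and inner operation on the
      left-hand side, faces 2 and 0 those on the right-hand side.\<close>
    using key[of "Graft [Lf, Graft [Lf, Graft [Lf, Lf]]]" x y z]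
      key[of "Graft [Lf, Graft [Graft [Lf, Lf], Lf]]" x y z]
      key[of "Graft [Lf, Graft [Lf, Lf, Lf]]" x y z]
      key[of "Graft [Graft [Lf, Lf], Graft [Lf, Lf]]" x y z]
      key[of "Graft [Graft [Lf, Graft [Lf, Lf]], Lf]" x y z]
      key[of "Graft [Graft [Graft [Lf, Lf], Lf], Lf]" x y z]
      key[of "Graft [Graft [Lf, Lf, Lf], Lf]" x y z]
      key[of "Graft [Lf, Lf, Graft [Lf, Lf]]" x y z]
      key[of "Graft [Lf, Graft [Lf, Lf], Lf]" x y z]
      key[of "Graft [Graft [Lf, Lf], Lf, Lf]" x y z]
      key[of "Graft [Lf, Lf, Lf, Lf]" x y z]
    by (simp add: trees_def)
  moreover have "lambda_of (\<Theta> 0) = L" "rho_of (\<Theta> 0) = R" "mu_of (\<Theta> 0) = M"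
    by (intro ext; simp add: \<Theta>0 lambda_of_def rho_of_def mu_of_def product_cochain_def tree_evaluation)+
  ultimately show ?thesis
    using \<Theta> by (simp add: deformation_def)
qed

end

theorem corollary4p12:
  fixes scale :: "'k::field \<Rightarrow> 'a::ab_group_add \<Rightarrow> 'a"
    and L R M :: "'a \<Rightarrow> 'a \<Rightarrow> 'a"
  assumes "triassociative_algebra scale L R M"
    and "triassociative_algebra.cohomology_trivial scale L R M 3"
  shows "\<forall>\<theta> \<in> triassociative_algebra.cocycles scale L R M 2.
           \<exists>\<Theta>. triassociative_algebra.deformation scale L R M \<Theta> \<and> infinitesimal \<Theta> = \<theta>"
proof
  interpret triassociative_algebra scale L R M by fact
  fix \<theta> assume "\<theta> \<in> cocycles 2"
  then obtain \<Theta> where "\<And>i. \<Theta> i \<in> cochains 2" "\<Theta> 0 = product_cochain" "\<Theta> 1 = \<theta>"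
    "\<And>n. circle_square \<Theta> n = (\<lambda>\<psi> as. 0)"
    using vanishing_circle_square_exists[OF assms(2)] by blast
  then show "\<exists>\<Theta>. deformation \<Theta> \<and> infinitesimal \<Theta> = \<theta>"
    using deformation_if_circle_square_vanishes[of \<Theta>] by (auto simp: infinitesimal_def)
qed

end
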